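(* Let $\lambda=(2,3,5,5,5)$ and let $Q^\lambda(t)=\sum_{\sigma}t^{\operatorname{asc}(\sigma)}$, the sum over all permutations $\sigma\in\mathfrak{S}_5$ with $\sigma_i\le\lambda_i$ for $i=1,\dots,5$. Then there is no positive integer $m$ and no sequence $\mathbf{s}=(s_1,\dots,s_m)$ of positive integers such that $Q^\lambda(t)=E^{(\mathbf{s})}_m(t)$.
   Context: $\operatorname{asc}(\sigma)$ is the number of $i\in[n-1]$ with $\sigma_i<\sigma_{i+1}$. For a sequence $\mathbf{s}=(s_1,\dots,s_m)$ of positive integers, the $\mathbf{s}$-inversion sequences are $\mathcal{I}^{(\mathbf{s})}_m=\{(e_1,\dots,e_m)\in\mathbb{Z}^m:0\le e_i<s_i\}$. The ascent set of $\mathbf{e}\in\mathcal{I}^{(\mathbf{s})}_m$ is $\operatorname{Asc}(\mathbf{e})=\{i\in\{0,1,\dots,m-1\}: e_i/s_i<e_{i+1}/s_{i+1}\}$, with the convention $e_0=0$, $s_0=1$, and $\operatorname{asc}(\mathbf{e})=|\operatorname{Asc}(\mathbf{e})|$. The $\mathbf{s}$-Eulerian polynomial is $E^{(\mathbf{s})}_m(t)=\sum_{\mathbf{e}\in\mathcal{I}^{(\mathbf{s})}_m}t^{\operatorname{asc}(\mathbf{e})}$. *)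

theory Defs
  imports "HOL-Combinatorics.Permutations" "HOL-Computational_Algebra.Polynomial"
begin

definition perm_asc :: "nat \<Rightarrow> (nat \<Rightarrow> nat) \<Rightarrow> nat" where
  "perm_asc n \<sigma> = card {i \<in> {1..n - 1}. \<sigma> i < \<sigma> (i + 1)}"

(* Lists are indexed from 0, so the entry lambda_i of the paper is lam ! (i - 1). *)
definition restricted_perms :: "nat list \<Rightarrow> (nat \<Rightarrow> nat) set" where
  "restricted_perms lam =
     {\<sigma>. \<sigma> permutes {1..length lam} \<and> (\<forall>i\<in>{1..length lam}. \<sigma> i \<le> lam ! (i - 1))}"

definition Q_poly :: "nat list \<Rightarrow> int poly" where
  "Q_poly lam = (\<Sum>\<sigma>\<in>restricted_perms lam. monom 1 (perm_asc (length lam) \<sigma>))"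

definition inv_seqs :: "int list \<Rightarrow> int list set" where
  "inv_seqs s = {e. length e = length s \<and> (\<forall>i<length s. 0 \<le> e ! i \<and> e ! i < s ! i)}"

(* Prepending 0 to e and 1 to s implements the convention e_0 = 0, s_0 = 1 and makes
   (0 # e) ! i and (1 # s) ! i the entries e_i and s_i for 0 <= i <= m. *)
definition Asc_set :: "int list \<Rightarrow> int list \<Rightarrow> nat set" where
  "Asc_set s e = {i \<in> {0..<length s}.
     (of_int ((0 # e) ! i) / of_int ((1 # s) ! i) :: rat)
       < of_int ((0 # e) ! (i + 1)) / of_int ((1 # s) ! (i + 1))}"

definition seq_asc :: "int list \<Rightarrow> int list \<Rightarrow> nat" where
  "seq_asc s e = card (Asc_set s e)"

definition s_Eulerian_poly :: "int list \<Rightarrow> int poly" where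
  "s_Eulerian_poly s = (\<Sum>e\<in>inv_seqs s. monom 1 (seq_asc s e))"

end

theory Submission
  imports Defs
begin

text \<open>The constant terms differ. The zero inversion sequence has no ascent, so an s-Eulerian
  polynomial has a positive constant term. A permutation without ascents is the decreasing one,
  which begins with \<open>n\<close>, and this is excluded as soon as \<open>\<lambda>\<^sub>1 < n\<close>.\<close>

text \<open>Reduces both sides to counting: only objects without ascents contribute to the constant
  term.\<close>

lemma coeff_0_sum_monom:
  assumes "finite A"
  shows "coeff (\<Sum>x\<in>A. monom (1::int) (f x)) 0 = int (card {x \<in> A. f x = 0})"
proof -
  have "coeff (\<Sum>x\<in>A. monom (1::int) (f x)) 0 = (\<Sum>x\<in>A. if f x = 0 then 1 else 0)"
    by (simp add: coeff_sum)
  also have "\<dots> = int (card {x \<in> A. f x = 0})"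
    using assms by (simp add: sum.If_cases Collect_conj_eq)
  finally show ?thesis .
qed

lemma finite_inv_seqs: "finite (inv_seqs s)"
proof (rule finite_subset)
  \<comment> \<open>The largest entry of \<open>s\<close> bounds all entries of \<open>e\<close> at
    once. If \<open>s\<close> is empty, \<open>Max\<close> is unspecified, but then \<open>e\<close>
    is the empty list.\<close>
  show "inv_seqs s \<subseteq> {e. set e \<subseteq> {0..Max (set s)} \<and> length e = length s}"
  proof
    fix e assume e: "e \<in> inv_seqs s"
    have "e ! i \<in> {0..Max (set s)}" if "i < length e" for i
    proof -
      have "0 \<le> e ! i" "e ! i < s ! i" "s ! i \<le> Max (set s)"
        using e that by (auto simp: inv_seqs_def)
      then show ?thesis by simp
    qed
    then show "e \<in> {e. set e \<subseteq> {0..Max (set s)} \<and> length e = length s}"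
      using e by (auto simp: inv_seqs_def in_set_conv_nth)
  qed
  show "finite {e. set e \<subseteq> {0..Max (set s)} \<and> length e = length s}"
    by (rule finite_lists_length_eq) simp
qed

lemma seq_asc_replicate_0: "seq_asc s (replicate (length s) 0) = 0"
proof -
  \<comment> \<open>The bound includes \<open>length s\<close>, since \<open>i + 1\<close> reaches
    it in \<open>Asc_set\<close>. Every comparison there becomes 0 < 0.\<close>
  have zero: "(0 # replicate (length s) (0::int)) ! i = 0" if "i \<le> length s" for i
    using that by (cases i) auto
  have "Asc_set s (replicate (length s) 0) = {}"
    unfolding Asc_set_def using zero by auto
  then show ?thesis by (simp add: seq_asc_def)
qed

lemma coeff_0_s_Eulerian_poly_pos:
  assumes "\<forall>x\<in>set s. x > 0"
  shows "coeff (s_Eulerian_poly s) 0 > 0"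
proof -
  let ?Z = "{e \<in> inv_seqs s. seq_asc s e = 0}"
  \<comment> \<open>Positivity of the entries of \<open>s\<close> makes 0 an admissible value at
    every position.\<close>
  have "replicate (length s) 0 \<in> ?Z"
    using assms by (auto simp: inv_seqs_def seq_asc_replicate_0)
  then have "card ?Z > 0"
    using finite_inv_seqs by (auto simp: card_gt_0_iff)
  then show ?thesis
    unfolding s_Eulerian_poly_def by (simp add: coeff_0_sum_monom finite_inv_seqs)
qed

lemma finite_restricted_perms: "finite (restricted_perms lam)"
  by (rule finite_subset[OF _ finite_permutations[of "{1..length lam}"]])
    (auto simp: restricted_perms_def)

text \<open>Without ascents each value is at most its predecessor, and these inequalities chain back
  to position 1.\<close>

lemma le_first_if_no_ascent:
  assumes "perm_asc n \<sigma> = 0" "1 \<le> k" "k \<le> n"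
  shows "\<sigma> k \<le> \<sigma> 1"
  using assms(2,3)
proof (induction k rule: dec_induct)
  case (step k)
  have "{i \<in> {1..n - 1}. \<sigma> i < \<sigma> (i + 1)} = {}"
    using assms(1) by (simp add: perm_asc_def)
  moreover have "k \<in> {1..n - 1}" using step by auto
  ultimately have "\<sigma> (Suc k) \<le> \<sigma> k" by (force simp: not_less)
  with step show ?case by simp
qed simp

lemma coeff_0_Q_poly:
  assumes "lam \<noteq> []" "hd lam < length lam"
  shows "coeff (Q_poly lam) 0 = 0"
proof -
  have "perm_asc (length lam) \<sigma> \<noteq> 0" if \<sigma>: "\<sigma> \<in> restricted_perms lam" for \<sigma>
  proof
    assume no_asc: "perm_asc (length lam) \<sigma> = 0"
    have perm: "\<sigma> permutes {1..length lam}" using \<sigma> by (simp add: restricted_perms_def)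
    \<comment> \<open>By surjectivity the largest value is attained somewhere; monotonicity then
      forces the first value to be at least that large.\<close>
    have "length lam \<in> \<sigma> ` {1..length lam}"
      using permutes_image[OF perm] assms(2) by simp
    then obtain k where k: "1 \<le> k" "k \<le> length lam" "\<sigma> k = length lam" by force
    then have "length lam \<le> \<sigma> 1" using le_first_if_no_ascent[OF no_asc] by metis
    moreover have "\<sigma> 1 \<le> hd lam"
      using \<sigma> assms by (force simp: restricted_perms_def hd_conv_nth)
    ultimately show False using assms(2) by simp
  qed
  then have none: "{\<sigma> \<in> restricted_perms lam. perm_asc (length lam) \<sigma> = 0} = {}" by blast
  show ?thesis
    unfolding Q_poly_def coeff_0_sum_monom[OF finite_restricted_perms] none by simp
qed

theorem theorem3p4:
  shows "\<not> (\<exists>(m::nat) (s::int list). m > 0 \<and> length s = m \<and> (\<forall>x\<in>set s. x > 0) \<and>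
           Q_poly [2, 3, 5, 5, 5] = s_Eulerian_poly s)"
  \<comment> \<open>Here the first bound is 2 < 5, so the constant term is 0 on the left and
    positive on the right.\<close>
  using coeff_0_Q_poly[of "[2, 3, 5, 5, 5]"] coeff_0_s_Eulerian_poly_pos by force

end
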